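(* Let $d\in\{2,3\}$, let $A$ be the coefficient matrix of the second-order finite difference discretization, on a uniform grid of size $h$, of the Poisson equation with Dirichlet boundary condition on a bounded domain $\Omega\subset\mathbb R^d$ (the matrix $A$ given explicitly in the context), and let $M$ be the MILU preconditioner of $A$ defined by the lexicographical order of the grid points. Then $$\kappa(M^{-1}A)\le 1+d+\frac{d\,\ell_{\max}}{h},$$ where $\ell_{\max}$ is the length of the longest side among the axes of the computational domain.
   Context: The computational domain is an axis-parallel box containing $\Omega$, discretized by a uniform grid of spacing $h$. The vertex set $\mathcal V$ is the set of grid points lying in $\Omega$. For $K\in\mathcal V$, $n_0(K)$ is the set of grid points $K'\in\mathcal V$ directly adjacent to $K$ along a grid line, and $B(K)$ is the set of grid points directly adjacent to $K$ along a grid line that lie outside $\Omega$ (so $|n_0(K)|+|B(K)|=2d$). For $K'\in B(K)$, $h_{K,K'}\in(0,h]$ is the distance from $K$ to $\partial\Omega$ along the grid line towards $K'$. The matrix is $$A_{K_1,K_2}=\begin{cases}-h^{-2}&\text{if }K_1\in n_0(K_2),\\ |n_0(K)|h^{-2}+\sum_{K'\in B(K)}(h_{K,K'}h)^{-1}&\text{if }K_1=K_2=K,\\ 0&\text{otherwise.}\end{cases}$$ The lexicographical order $\prec$ compares grid points lexicographically by coordinates. Precursors and successors: $p(K)=\{K'\in n_0(K):K'\prec K\}$, $s(K)=\{K'\in n_0(K):K\prec K'\}$. MILU preconditioner: write $A=L+D+L^\top$ with $D$ the diagonal of $A$ and $L_{K,K'}=A_{K,K'}$ if $K'\in p(K)$,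 $0$ otherwise. Define recursively along $\prec$ $$e_K=A_{K,K}-\sum_{K_1\in p(K)}\ \sum_{K_2\in s(K_1)}\frac{A_{K,K_1}A_{K_1,K_2}}{e_{K_1}},$$ $E=\mathrm{diag}(e_K)$, and $M=(L+E)E^{-1}(L+E)^\top$. $\kappa(\cdot)=\lambda_{\max}/\lambda_{\min}$ is the ratio of the largest to the smallest eigenvalue. *)

theory Defs
  imports "HOL-Analysis.Analysis" "HOL-Library.Fun_Lexorder"
begin

text \<open>
  The coordinate axes are indexed by a finite linearly ordered type, so that grid points can be
  compared lexicographically. The computational domain is the box with lower corner \<open>a\<close> and sides
  of length \<open>h * N $ i\<close>; \<open>\<Omega>\<close> is the open domain on which the Poisson equation is posed.
\<close>

definition grid :: "real^'d \<Rightarrow> real \<Rightarrow> nat^'d \<Rightarrow> (real^'d) set" where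
  "grid a h N = {(\<chi> i. a $ i + h * real (k $ i)) | k. \<forall>i. k $ i \<le> N $ i}"

definition vertices :: "(real^'d) set \<Rightarrow> real^'d \<Rightarrow> real \<Rightarrow> nat^'d \<Rightarrow> (real^'d) set" where
  "vertices \<Omega> a h N = grid a h N \<inter> \<Omega>"

definition adjacent :: "real \<Rightarrow> real^'d \<Rightarrow> real^'d \<Rightarrow> bool" where
  "adjacent h K K' \<longleftrightarrow> (\<exists>i. K' = K + h *\<^sub>R axis i 1 \<or> K' = K - h *\<^sub>R axis i 1)"

definition inner_nbrs ::
    "(real^'d) set \<Rightarrow> real^'d \<Rightarrow> real \<Rightarrow> nat^'d \<Rightarrow> real^'d \<Rightarrow> (real^'d) set" where
  "inner_nbrs \<Omega> a h N K = {K' \<in> vertices \<Omega> a h N. adjacent h K K'}"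

definition outer_nbrs ::
    "(real^'d) set \<Rightarrow> real^'d \<Rightarrow> real \<Rightarrow> nat^'d \<Rightarrow> real^'d \<Rightarrow> (real^'d) set" where
  "outer_nbrs \<Omega> a h N K = {K' \<in> grid a h N - \<Omega>. adjacent h K K'}"

text \<open>
  The distance from \<open>K\<close> to the boundary of \<open>\<Omega>\<close> along the grid line towards \<open>K'\<close>. For open \<open>\<Omega>\<close>,
  \<open>K \<in> \<Omega>\<close> and \<open>K' \<notin> \<Omega>\<close>, the set below is nonempty and closed and does not contain \<open>K\<close>, so
  the value lies between \<open>0\<close> (excluded) and \<open>dist K K'\<close>.
\<close>

definition bdist :: "(real^'d) set \<Rightarrow> real^'d \<Rightarrow> real^'d \<Rightarrow> real" where
  "bdist \<Omega> K K' = infdist K (frontier \<Omega> \<inter> closed_segment K K')"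

definition poisson ::
    "(real^'d) set \<Rightarrow> real^'d \<Rightarrow> real \<Rightarrow> nat^'d \<Rightarrow> real^'d \<Rightarrow> real^'d \<Rightarrow> real" where
  "poisson \<Omega> a h N K1 K2 =
     (if K1 \<in> inner_nbrs \<Omega> a h N K2 then - (1 / h\<^sup>2)
      else if K1 = K2 then
        real (card (inner_nbrs \<Omega> a h N K1)) / h\<^sup>2
          + (\<Sum>K'\<in>outer_nbrs \<Omega> a h N K1. 1 / (bdist \<Omega> K1 K' * h))
      else 0)"

definition lex_less :: "real^'d::{finite,linorder} \<Rightarrow> real^'d::{finite,linorder} \<Rightarrow> bool" where
  "lex_less K K' \<longleftrightarrow> less_fun (($) K) (($) K')"

definition precursors where
  "precursors \<Omega> a h N K = {K' \<in> inner_nbrs \<Omega> a h N K. lex_less K' K}"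

definition successors where
  "successors \<Omega> a h N K = {K' \<in> inner_nbrs \<Omega> a h N K. lex_less K K'}"

lemma finite_grid:
  fixes a :: "real^'d"
  shows "finite (grid a h N)"
proof -
  have "finite {f :: 'd \<Rightarrow> nat. \<forall>i. f i \<in> {..N $ i}}"
    using finite_PiE[of "UNIV :: 'd set" "\<lambda>i. {..N $ i}"] by (simp add: PiE_def Pi_def)
  moreover have "grid a h N \<subseteq>
      (\<lambda>f. \<chi> i. a $ i + h * real (f i)) ` {f :: 'd \<Rightarrow> nat. \<forall>i. f i \<in> {..N $ i}}"
    unfolding grid_def by auto
  ultimately show ?thesis
    by (meson finite_imageI finite_subset)
qed

lemma not_lex_less_self: "\<not> lex_less K K"
  by (simp add: lex_less_def less_fun_irrefl)

lemma lex_less_trans: "lex_less K K' \<Longrightarrow> lex_less K' K'' \<Longrightarrow> lex_less K K''"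
  unfolding lex_less_def by (rule less_fun_trans)

function milu_pivot where
  "milu_pivot \<Omega> a h N K =
     poisson \<Omega> a h N K K
       - (\<Sum>K1\<in>precursors \<Omega> a h N K. \<Sum>K2\<in>successors \<Omega> a h N K1.
            poisson \<Omega> a h N K K1 * poisson \<Omega> a h N K1 K2 / milu_pivot \<Omega> a h N K1)"
  by pat_completeness auto
termination
proof (relation "Wellfounded.measure (\<lambda>(\<Omega>, a, h, N, K). card {K' \<in> vertices \<Omega> a h N. lex_less K' K})", simp)
  fix \<Omega> :: "(real^'d::{finite,linorder}) set" and a h N K K1 K2
  assume "K1 \<in> precursors \<Omega> a h N K"
  then have "K1 \<in> vertices \<Omega> a h N" "lex_less K1 K"
    by (auto simp: precursors_def inner_nbrs_def)
  then have "{K' \<in> vertices \<Omega> a h N. lex_less K' K1} \<subset> {K' \<in> vertices \<Omega> a h N. lex_less K' K}"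
    using lex_less_trans not_lex_less_self by blast
  moreover have "finite {K' \<in> vertices \<Omega> a h N. lex_less K' K}"
    by (simp add: vertices_def finite_grid)
  ultimately show "((\<Omega>, a, h, N, K1), (\<Omega>, a, h, N, K))
      \<in> Wellfounded.measure (\<lambda>(\<Omega>, a, h, N, K). card {K' \<in> vertices \<Omega> a h N. lex_less K' K})"
    by (simp add: psubset_card_mono)
qed

declare milu_pivot.simps [simp del]

text \<open>
  Matrices over the vertex set are represented through an enumeration \<open>v\<close> of the vertices by a
  finite type.
\<close>

definition poisson_matrix ::
    "(real^'d) set \<Rightarrow> real^'d \<Rightarrow> real \<Rightarrow> nat^'d \<Rightarrow> ('v \<Rightarrow> real^'d) \<Rightarrow> real^'v^'v" where
  "poisson_matrix \<Omega> a h N v = (\<chi> i j. poisson \<Omega> a h N (v i) (v j))"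

definition lower_part where
  "lower_part \<Omega> a h N v =
     ((\<chi> i j. if v j \<in> precursors \<Omega> a h N (v i)
                then poisson_matrix \<Omega> a h N v $ i $ j else 0) :: real^'v^'v)"

definition pivot_matrix where
  "pivot_matrix \<Omega> a h N v = ((\<chi> i j. if i = j then milu_pivot \<Omega> a h N (v i) else 0) :: real^'v^'v)"

definition milu where
  "milu \<Omega> a h N v =
     (let L = lower_part \<Omega> a h N v; E = pivot_matrix \<Omega> a h N v
      in (L + E) ** matrix_inv E ** transpose (L + E))"

definition eigenvalues :: "real^'n^'n \<Rightarrow> real set" where
  "eigenvalues X = {c. \<exists>x. x \<noteq> 0 \<and> X *v x = c *s x}"

text \<open>
  Only meaningful for matrices whose eigenvalues are all real and positive, such as a product of
  two symmetric positive definite matrices.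
\<close>

definition cond_number :: "real^'n^'n \<Rightarrow> real" where
  "cond_number X = Max (eigenvalues X) / Min (eigenvalues X)"

end

theory Submission
  imports Defs
begin

text \<open>
  Write \<open>q = 1 / h\<^sup>2\<close> and \<open>d\<close> for the dimension. The condition number is estimated by comparing the
  quadratic forms of \<open>A\<close> and \<open>M\<close>: if the form of \<open>A\<close> lies between the form of \<open>M\<close> and \<open>C\<close> times the form of \<open>M\<close>,
  then all eigenvalues of \<open>M\<^sup>-\<^sup>1 A\<close> lie between \<open>1\<close> and \<open>C\<close> (\<open>cond_number_le_if_form_bounds\<close>).

  Eliminating a vertex \<open>k\<close> couples any two of its successors by an entry of size \<open>q\<^sup>2 / e\<^sub>k\<close>; the modified
  factorization drops this fill-in and corrects the diagonal so that \<open>M\<close> has the row sums of \<open>A\<close>.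
  Consequently the form of \<open>A - M\<close> is a sum over \<open>k\<close> of \<open>q\<^sup>2 / e\<^sub>k\<close> times the sum of \<open>(x\<^sub>i - x\<^sub>j)\<^sup>2\<close> over pairs of
  successors of \<open>k\<close> (\<open>form_A_minus_form_M\<close>). It is nonnegative, which gives the lower bound.

  For the upper bound, this sum over pairs is at most \<open>d\<close> times the sum of \<open>(x\<^sub>j - x\<^sub>k)\<^sup>2\<close> over the
  successors \<open>j\<close> of \<open>k\<close>, which is part of the energy measured by \<open>A\<close> (\<open>edge_energy_le_form_A\<close>). The pivots
  exceed \<open>d q\<close> by an amount that decays only slowly along the grid: \<open>e\<^sub>k \<ge> d q (1 + 1 / (l + 1))\<close>, where \<open>l\<close> is
  the sum of the integer coordinates of \<open>k\<close> (\<open>pivot_ge\<close>). So the form of \<open>A - M\<close> is at most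
  \<open>1 - 1 / (m + 2)\<close> times the form of \<open>A\<close>, where \<open>m\<close> bounds all coordinate sums, and \<open>C = m + 2\<close> is
  possible (\<open>form_A_le_form_M\<close>). On a box with sides at most \<open>\<ell>\<close> one can take \<open>m\<close> at most \<open>d \<ell> / h\<close>, and
  \<open>m + 2 \<le> 1 + d + d \<ell> / h\<close>.
\<close>

section \<open>Eigenvalues of symmetric pencils\<close>

lemma matrix_inv_left_right:
  fixes X :: "real^'n^'n"
  assumes "invertible X"
  shows "matrix_inv X ** X = mat 1" and "X ** matrix_inv X = mat 1"
  using someI_ex[OF assms[unfolded invertible_def]] by (auto simp: matrix_inv_def)

lemma invertible_if_pos_def:
  fixes M :: "real^'n^'n"
  assumes "\<And>x. x \<noteq> 0 \<Longrightarrow> x \<bullet> (M *v x) > 0"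
  shows "invertible M"
proof -
  have "\<forall>x. M *v x = 0 \<longrightarrow> x = 0"
    using assms by (metis inner_zero_right less_irrefl)
  then show ?thesis
    by (simp add: invertible_left_inverse matrix_left_invertible_ker)
qed

lemma inner_matrix_vector_symmetric:
  fixes A :: "real^'n^'n"
  assumes "transpose A = A"
  shows "x \<bullet> (A *v y) = (A *v x) \<bullet> y"
  by (metis assms dot_lmul_matrix transpose_matrix_vector)

text \<open>
  Eigenvalues of \<open>M\<^sup>-\<^sup>1 A\<close> are studied through the pencil \<open>A x = c M x\<close>, whose two sides are symmetric
  although \<open>M\<^sup>-\<^sup>1 A\<close> itself is not.
\<close>
lemma eigenvalue_pencil_iff:
  fixes A M :: "real^'n^'n"
  assumes "invertible M"
  shows "c \<in> eigenvalues (matrix_inv M ** A) \<longleftrightarrow> (\<exists>x. x \<noteq> 0 \<and> A *v x = c *\<^sub>R (M *v x))"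
proof -
  have "(matrix_inv M ** A) *v x = c *s x \<longleftrightarrow> A *v x = c *\<^sub>R (M *v x)" for x
  proof
    assume "(matrix_inv M ** A) *v x = c *s x"
    then have "M *v ((matrix_inv M ** A) *v x) = M *v (c *\<^sub>R x)"
      by (simp add: scalar_mult_eq_scaleR)
    then show "A *v x = c *\<^sub>R (M *v x)"
      by (simp add: matrix_vector_mul_assoc matrix_mul_assoc matrix_inv_left_right[OF assms]
          matrix_vector_mult_scaleR)
  next
    assume "A *v x = c *\<^sub>R (M *v x)"
    then have "matrix_inv M *v (A *v x) = matrix_inv M *v (c *\<^sub>R (M *v x))"
      by simp
    then show "(matrix_inv M ** A) *v x = c *s x"
      by (simp add: matrix_vector_mul_assoc matrix_inv_left_right[OF assms]
          matrix_vector_mult_scaleR scalar_mult_eq_scaleR)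
  qed
  then show ?thesis
    by (simp add: eigenvalues_def)
qed

text \<open>
  Symmetry of \<open>A\<close> and \<open>M\<close> makes eigenvectors for distinct \<open>c\<close> orthogonal in the inner product of \<open>M\<close>,
  hence linearly independent, so there are at most as many eigenvalues as dimensions.
\<close>
lemma finite_pencil_eigenvalues:
  fixes A M :: "real^'n^'n"
  assumes A: "transpose A = A" and M: "transpose M = M"
    and pos: "\<And>x. x \<noteq> 0 \<Longrightarrow> x \<bullet> (M *v x) > 0"
  shows "finite {c. \<exists>x. x \<noteq> 0 \<and> A *v x = c *\<^sub>R (M *v x)}" (is "finite ?C")
proof -
  define w where "w c = (SOME x. x \<noteq> 0 \<and> A *v x = c *\<^sub>R (M *v x))" for c
  have w: "w c \<noteq> 0 \<and> A *v w c = c *\<^sub>R (M *v w c)" if "c \<in> ?C" for c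
    using someI_ex[OF CollectD[OF that]] unfolding w_def .
  have orth: "w c \<bullet> (M *v w c') = 0" if "c \<in> ?C" "c' \<in> ?C" "c \<noteq> c'" for c c'
  proof -
    have "c' * (w c \<bullet> (M *v w c')) = w c \<bullet> (A *v w c')"
      using w[OF that(2)] by simp
    also have "\<dots> = c * (w c \<bullet> (M *v w c'))"
      using w[OF that(1)] inner_matrix_vector_symmetric[OF A] inner_matrix_vector_symmetric[OF M]
      by simp
    finally show ?thesis
      using that(3) by simp
  qed
  have inj: "inj_on w ?C"
  proof (rule inj_onI, rule ccontr)
    fix c c' assume c: "c \<in> ?C" "c' \<in> ?C" "w c = w c'" "c \<noteq> c'"
    have "w c \<bullet> (M *v w c) = 0"
      using orth[OF c(1,2,4)] unfolding c(3) .
    then show False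
      using pos[of "w c"] w[OF c(1)] by simp
  qed
  have "independent (w ` ?C)"
    unfolding dependent_explicit
  proof clarify
    fix T u v
    assume T: "finite T" "T \<subseteq> w ` ?C" "(\<Sum>v\<in>T. u v *\<^sub>R v) = 0" and v: "v \<in> T" "u v \<noteq> 0"
    have "0 = (\<Sum>y\<in>T. u y *\<^sub>R y) \<bullet> (M *v v)"
      by (simp add: T)
    also have "\<dots> = (\<Sum>y\<in>T. u y * (y \<bullet> (M *v v)))"
      by (simp add: inner_sum_left)
    also have "\<dots> = (\<Sum>y\<in>T. if y = v then u v * (v \<bullet> (M *v v)) else 0)"
    proof (rule sum.cong)
      fix y assume "y \<in> T"
      then obtain c c' where "c \<in> ?C" "y = w c" "c' \<in> ?C" "v = w c'"
        using T(2) v(1) by blast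
      then show "u y * (y \<bullet> (M *v v)) = (if y = v then u v * (v \<bullet> (M *v v)) else 0)"
        using orth[of c c'] by (cases "c = c'") auto
    qed simp
    also have "\<dots> = u v * (v \<bullet> (M *v v))"
      using T(1) v(1) by simp
    finally have "v \<bullet> (M *v v) = 0"
      using v(2) by simp
    moreover obtain c where "c \<in> ?C" "v = w c"
      using T(2) v(1) by blast
    then have "v \<noteq> 0"
      using w[of c] by simp
    ultimately show False
      using pos[of v] by simp
  qed
  then have "finite (w ` ?C)"
    using independent_bound by blast
  then show ?thesis
    using inj finite_imageD by blast
qed

text \<open>
  A positive semidefinite form is minimal where it vanishes, so its gradient \<open>2 Q x\<close> is zero there:
  otherwise a short step along \<open>- Q x\<close> would make the form negative.
\<close>
lemma psd_form_zero_imp_kernel: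
  fixes Q :: "real^'n^'n"
  assumes Q: "transpose Q = Q" and psd: "\<And>y. y \<bullet> (Q *v y) \<ge> 0" and z: "x \<bullet> (Q *v x) = 0"
  shows "Q *v x = 0"
proof (rule ccontr)
  assume nz: "Q *v x \<noteq> 0"
  define y where "y = Q *v x"
  define p where "p = y \<bullet> y"
  define r where "r = y \<bullet> (Q *v y)"
  have p: "p > 0" and r: "r \<ge> 0"
    using nz psd by (auto simp: p_def r_def y_def)
  have expand: "(x - t *\<^sub>R y) \<bullet> (Q *v (x - t *\<^sub>R y)) = t\<^sup>2 * r - 2 * t * p" for t
  proof -
    have "x \<bullet> (Q *v y) = p"
      using inner_matrix_vector_symmetric[OF Q, of x y] by (simp add: p_def y_def)
    moreover have "y \<bullet> (Q *v x) = p"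
      by (simp add: p_def y_def)
    ultimately show ?thesis
      using z by (simp add: matrix_vector_mult_diff_distrib matrix_vector_mult_scaleR inner_diff_left
          inner_diff_right r_def power2_eq_square algebra_simps)
  qed
  \<comment> \<open>The form at \<open>x - t y\<close> is \<open>t (t r - 2 p)\<close>; the summand \<open>1\<close> keeps the step length defined when \<open>r = 0\<close>.\<close>
  define t where "t = p / (r + 1)"
  have "t > 0"
    using p r by (simp add: t_def)
  have "t * r < 2 * p"
  proof -
    have "t * r \<le> t * (r + 1)" using \<open>t > 0\<close> by simp
    also have "\<dots> = p" using r by (simp add: t_def)
    finally show ?thesis using p by linarith
  qed
  then have "t * (t * r - 2 * p) < 0"
    using \<open>t > 0\<close> by (simp add: mult_pos_neg)
  then show False
    using psd[of "x - t *\<^sub>R y"] unfolding expand by (simp add: power2_eq_square algebra_simps)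
qed

text \<open>
  The maximum \<open>c\<close> of the Rayleigh quotient of \<open>A\<close> with respect to \<open>M\<close> is an eigenvalue: \<open>c M - A\<close> is then
  positive semidefinite and its form vanishes at a maximizer.
\<close>
lemma pencil_eigenvalue_exists:
  fixes A M :: "real^'n^'n"
  assumes A: "transpose A = A" and M: "transpose M = M"
    and pos: "\<And>x. x \<noteq> 0 \<Longrightarrow> x \<bullet> (M *v x) > 0"
  shows "\<exists>c x. x \<noteq> 0 \<and> A *v x = c *\<^sub>R (M *v x)"
proof -
  define R where "R = (\<lambda>x. (x \<bullet> (A *v x)) / (x \<bullet> (M *v x)))"
  have "x \<bullet> (M *v x) \<noteq> 0" if "x \<in> sphere 0 1" for x
    using pos[of x] that by (cases "x = 0") auto
  then have "continuous_on (sphere 0 1) R"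
    unfolding R_def
    by (intro continuous_intros linear_continuous_on matrix_vector_mul_bounded_linear ballI)
  moreover have "sphere (0::real^'n) 1 \<noteq> {}"
    by simp
  ultimately obtain x where x: "x \<in> sphere 0 1" and max: "\<And>y. y \<in> sphere 0 1 \<Longrightarrow> R y \<le> R x"
    using continuous_attains_sup[OF compact_sphere] by metis
  then have "x \<noteq> 0" by auto
  define Q where "Q = R x *\<^sub>R M - A"
  have Qv: "Q *v y = R x *\<^sub>R (M *v y) - A *v y" for y
    by (simp add: Q_def matrix_vector_mult_diff_rdistrib scaleR_matrix_vector_assoc)
  have "Q *v x = 0"
  proof (rule psd_form_zero_imp_kernel)
    show "transpose Q = Q"
      using A M by (simp add: Q_def vec_eq_iff transpose_def)
    show "x \<bullet> (Q *v x) = 0"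
      using pos[OF \<open>x \<noteq> 0\<close>] by (simp add: Qv inner_diff_right R_def)
    fix y :: "real^'n"
    show "y \<bullet> (Q *v y) \<ge> 0"
    proof (cases "y = 0")
      case False
      define u where "u = (1 / norm y) *\<^sub>R y"
      have "R u = R y"
        using False by (simp add: R_def u_def matrix_vector_mult_scaleR)
      moreover have "R u \<le> R x"
        using False by (intro max) (simp add: u_def)
      ultimately have "R y * (y \<bullet> (M *v y)) \<le> R x * (y \<bullet> (M *v y))"
        using pos[OF False] by (simp add: mult_right_mono)
      moreover have "R y * (y \<bullet> (M *v y)) = y \<bullet> (A *v y)"
        using pos[OF False] by (simp add: R_def)
      ultimately show ?thesis
        by (simp add: Qv inner_diff_right)
    qed simp
  qed
  then show ?thesis
    using \<open>x \<noteq> 0\<close> Qv by (metis eq_iff_diff_eq_0)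
qed

text \<open>
  The form bounds put every eigenvalue of \<open>M\<^sup>-\<^sup>1 A\<close> in the interval from \<open>1\<close> to \<open>C\<close>. Since \<open>Max\<close> and \<open>Min\<close>
  are meaningful only on finite nonempty sets, finiteness and existence of the eigenvalues are part of
  the argument.
\<close>
theorem cond_number_le_if_form_bounds:
  fixes A M :: "real^'n^'n"
  assumes A: "transpose A = A" and M: "transpose M = M"
    and pos: "\<And>x. x \<noteq> 0 \<Longrightarrow> x \<bullet> (M *v x) > 0"
    and lower: "\<And>x. x \<bullet> (M *v x) \<le> x \<bullet> (A *v x)"
    and upper: "\<And>x. x \<bullet> (A *v x) \<le> C * (x \<bullet> (M *v x))"
  shows "cond_number (matrix_inv M ** A) \<le> C"
proof -
  let ?S = "eigenvalues (matrix_inv M ** A)"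
  have S: "?S = {c. \<exists>x. x \<noteq> 0 \<and> A *v x = c *\<^sub>R (M *v x)}"
    using eigenvalue_pencil_iff[OF invertible_if_pos_def[OF pos]] by auto
  have fin: "finite ?S" and ne: "?S \<noteq> {}"
    using finite_pencil_eigenvalues[OF A M pos] pencil_eigenvalue_exists[OF A M pos] unfolding S by auto
  have bounds: "1 \<le> c \<and> c \<le> C" if "c \<in> ?S" for c
  proof -
    from that have "\<exists>x. x \<noteq> 0 \<and> A *v x = c *\<^sub>R (M *v x)"
      unfolding S by (rule CollectD)
    then obtain x where x: "x \<noteq> 0" "A *v x = c *\<^sub>R (M *v x)"
      by auto
    have "x \<bullet> (A *v x) = c * (x \<bullet> (M *v x))"
      unfolding x(2) by simp
    with lower[of x] upper[of x]
    have "1 * (x \<bullet> (M *v x)) \<le> c * (x \<bullet> (M *v x))" "c * (x \<bullet> (M *v x)) \<le> C * (x \<bullet> (M *v x))"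
      by linarith+
    then show ?thesis
      using pos[OF x(1)] by (meson mult_right_le_imp_le)
  qed
  have "Min ?S \<ge> 1" "Max ?S \<le> C"
    using bounds Min_in[OF fin ne] Max_in[OF fin ne] by blast+
  moreover have "0 \<le> Max ?S"
    using bounds[OF Max_in[OF fin ne]] by linarith
  ultimately have "Max ?S / Min ?S \<le> Max ?S / 1"
    by (intro divide_left_mono) simp_all
  then show ?thesis
    using \<open>Max ?S \<le> C\<close> by (simp add: cond_number_def)
qed

section \<open>Modified incomplete factorization on graded digraphs\<close>

text \<open>
  The left-hand side is \<open>card S\<close> times the sum of squared deviations from the mean of \<open>f\<close>, and the mean
  is the point for which that sum is smallest.
\<close>
lemma sum_dispersion_le:
  fixes f :: "'a \<Rightarrow> real"
  shows "real (card S) * (\<Sum>j\<in>S. (f j)\<^sup>2) - (\<Sum>j\<in>S. f j)\<^sup>2 \<le> real (card S) * (\<Sum>j\<in>S. (f j - t)\<^sup>2)"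
proof -
  define n where "n = real (card S)"
  define T where "T = (\<Sum>j\<in>S. f j)"
  define Q where "Q = (\<Sum>j\<in>S. (f j)\<^sup>2)"
  have sq: "(\<Sum>j\<in>S. (f j - t)\<^sup>2) = Q - 2 * t * T + n * t\<^sup>2"
    by (simp add: power2_diff sum.distrib sum_subtractf sum_distrib_left sum_distrib_right
        n_def T_def Q_def mult_ac)
  have "n * (\<Sum>j\<in>S. (f j - t)\<^sup>2) - (n * Q - T\<^sup>2) = (T - n * t)\<^sup>2"
    unfolding sq by (simp add: algebra_simps power2_eq_square)
  moreover have "(T - n * t)\<^sup>2 \<ge> 0"
    by simp
  ultimately show ?thesis
    unfolding n_def T_def Q_def by linarith
qed

text \<open>
  All that the factorization sees of the grid: the successor relation, its compatibility with a level
  function, in- and out-degree at most \<open>d\<close>, the common value \<open>- q\<close> of the off-diagonal entries, and a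
  weakly dominant diagonal. The level of a grid point is the sum of its integer coordinates, so each
  edge raises it by exactly one.
\<close>
locale milu_digraph =
  fixes succ :: "'v::finite \<Rightarrow> 'v set" and lev :: "'v \<Rightarrow> nat" and d :: nat and q :: real
    and D e :: "'v \<Rightarrow> real"
  assumes lev_succ: "j \<in> succ i \<Longrightarrow> lev j = Suc (lev i)"
    and d_pos: "d > 0" and q_pos: "q > 0"
    and card_succ: "card (succ i) \<le> d"
    and card_pred: "card {k. i \<in> succ k} \<le> d"
    and diag_ge: "2 * real d * q \<le> D i"
    and pivot: "e i = D i - (\<Sum>k | i \<in> succ k. q\<^sup>2 * real (card (succ k)) / e k)"
begin

definition A :: "real^'v^'v" where
  "A = (\<chi> i j. if j \<in> succ i \<or> i \<in> succ j then - q else if i = j then D i else 0)"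

definition L :: "real^'v^'v" where
  "L = (\<chi> i j. if i \<in> succ j then - q else 0)"

definition E :: "real^'v^'v" where
  "E = (\<chi> i j. if i = j then e i else 0)"

definition M :: "real^'v^'v" where
  "M = (L + E) ** matrix_inv E ** transpose (L + E)"

text \<open>
  The function \<open>l \<mapsto> 1 + 1 / (l + 1)\<close> solves the pivot recursion in the worst case, namely when the
  diagonal is \<open>2 d q\<close> and all vertices have \<open>d\<close> predecessors and \<open>d\<close> successors: if the predecessors
  satisfy the bound at level \<open>l - 1\<close>, the pivot is at least
  \<open>2 d q - d q / (1 + 1 / l) = d q (1 + 1 / (l + 1))\<close>. A vertex without predecessors has pivot at least \<open>2 d q\<close>,
  which is at least the claimed bound at any level.
\<close>
lemma pivot_ge: "real d * q * (1 + 1 / (real (lev i) + 1)) \<le> e i"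
proof (induction "lev i" arbitrary: i rule: less_induct)
  case less
  define l where "l = real (lev i)"
  have l: "l \<ge> 0" by (simp add: l_def)
  have term_le: "q\<^sup>2 * real (card (succ k)) / e k \<le> q * (l / (l + 1))" if k: "i \<in> succ k" for k
  proof -
    have lev: "lev i = Suc (lev k)" using lev_succ[OF k] .
    then have l1: "l \<ge> 1" and lk: "real (lev k) + 1 = l" by (simp_all add: l_def)
    have ek: "real d * q * (1 + 1 / l) \<le> e k"
      using less[of k] lev lk by simp
    have pos: "real d * q * (1 + 1 / l) > 0"
      using d_pos q_pos l1 by (intro mult_pos_pos) (auto intro: add_pos_nonneg)
    have "q\<^sup>2 * real (card (succ k)) / e k \<le> q\<^sup>2 * real d / (real d * q * (1 + 1 / l))"
      using ek pos card_succ[of k] by (intro frac_le) (auto intro: mult_left_mono)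
    also have "\<dots> = q * (l / (l + 1))"
    proof -
      have "1 + 1 / l = (l + 1) / l"
        using l1 by (simp add: field_simps)
      then show ?thesis
        using d_pos q_pos by (simp add: power2_eq_square)
    qed
    finally show ?thesis .
  qed
  have "(\<Sum>k | i \<in> succ k. q\<^sup>2 * real (card (succ k)) / e k)
      \<le> real (card {k. i \<in> succ k}) * (q * (l / (l + 1)))"
    using term_le by (intro sum_bounded_above) auto
  also have "\<dots> \<le> real d * (q * (l / (l + 1)))"
    using card_pred[of i] q_pos l by (intro mult_right_mono) auto
  finally have "2 * real d * q - real d * (q * (l / (l + 1))) \<le> e i"
    using pivot[of i] diag_ge[of i] by linarith
  moreover have "2 * real d * q - real d * (q * (l / (l + 1))) = real d * q * (1 + 1 / (l + 1))"
    using l by (simp add: field_simps)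
  ultimately show ?case by (simp add: l_def)
qed

lemma pivot_pos: "e i > 0"
proof -
  have "real d * q * (1 + 1 / (real (lev i) + 1)) > 0"
    using d_pos q_pos by (intro mult_pos_pos) (auto intro: add_pos_nonneg)
  then show ?thesis
    using pivot_ge[of i] by linarith
qed

lemma sum_edges_swap: "(\<Sum>i\<in>UNIV. \<Sum>k | i \<in> succ k. f k i) = (\<Sum>k\<in>UNIV. \<Sum>i\<in>succ k. f k i)"
  for f :: "'v \<Rightarrow> 'v \<Rightarrow> real"
  using sum.swap_restrict[of "UNIV :: 'v set" "UNIV :: 'v set" "\<lambda>i k. f k i" "\<lambda>i k. i \<in> succ k"]
  by simp

lemma quadratic_form_A:
  "x \<bullet> (A *v x) = (\<Sum>i\<in>UNIV. D i * (x $ i)\<^sup>2 - 2 * q * (x $ i * (\<Sum>j\<in>succ i. x $ j)))"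
proof -
  have "A $ i $ j * x $ j = (if j = i then D i * x $ i else 0)
      - (if j \<in> succ i then q * x $ j else 0) - (if i \<in> succ j then q * x $ j else 0)" for i j
    using lev_succ[of i j] lev_succ[of j i] by (auto simp: A_def)
  then have Ax: "(A *v x) $ i = D i * x $ i - q * (\<Sum>j\<in>succ i. x $ j) - q * (\<Sum>j | i \<in> succ j. x $ j)"
    for i
    by (simp add: matrix_vector_mult_def sum_subtractf sum.inter_filter[symmetric] sum_distrib_left)
  have "(\<Sum>i\<in>UNIV. x $ i * (\<Sum>j | i \<in> succ j. x $ j)) = (\<Sum>i\<in>UNIV. x $ i * (\<Sum>j\<in>succ i. x $ j))"
    using sum_edges_swap[of "\<lambda>k i. x $ i * x $ k"] by (simp add: sum_distrib_left mult.commute)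
  moreover have "x $ i * (A *v x) $ i = D i * (x $ i)\<^sup>2 - q * (x $ i * (\<Sum>j\<in>succ i. x $ j))
      - q * (x $ i * (\<Sum>j | i \<in> succ j. x $ j))" for i
    by (simp add: Ax right_diff_distrib power2_eq_square mult_ac)
  ultimately show ?thesis
    by (simp add: inner_vec_def sum_subtractf sum_distrib_left[symmetric] mult.assoc)
qed

lemma transpose_A: "transpose A = A"
  by (auto simp: A_def transpose_def vec_eq_iff)

lemma matrix_inv_E: "matrix_inv E = (\<chi> i j. if i = j then 1 / e i else 0)" (is "_ = ?F")
proof -
  have "e i \<noteq> 0" for i using pivot_pos[of i] by simp
  then have EF: "E ** ?F = mat 1" "?F ** E = mat 1"
    by (auto simp: E_def matrix_matrix_mult_def mat_def vec_eq_iff if_distrib[of "\<lambda>y. y * _"] cong: if_cong)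
  then have "invertible E"
    unfolding invertible_def by (intro exI[of _ ?F]) simp
  then have "?F = matrix_inv E ** E ** ?F"
    by (simp add: matrix_inv_left_right)
  also have "\<dots> = matrix_inv E"
    by (simp add: matrix_mul_assoc[symmetric] EF)
  finally show ?thesis ..
qed

lemma transpose_M: "transpose M = M"
proof -
  have "transpose (matrix_inv E) = matrix_inv E"
    by (auto simp: matrix_inv_E transpose_def vec_eq_iff)
  then show ?thesis
    by (simp add: M_def matrix_transpose_mul transpose_transpose matrix_mul_assoc)
qed

lemma quadratic_form_M:
  "x \<bullet> (M *v x) = (\<Sum>i\<in>UNIV. (e i * x $ i - q * (\<Sum>j\<in>succ i. x $ j))\<^sup>2 / e i)"
proof -
  define y where "y = transpose (L + E) *v x"
  have "(L + E) $ j $ i * x $ j = (if j = i then e i * x $ i else 0)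
      - (if j \<in> succ i then q * x $ j else 0)" for i j
    by (simp add: L_def E_def distrib_right)
  then have y: "y $ i = e i * x $ i - q * (\<Sum>j\<in>succ i. x $ j)" for i
    by (simp add: y_def matrix_vector_mult_def transpose_def vector_matrix_mult_def
        sum_subtractf sum.inter_filter[symmetric] sum_distrib_left)
  have "M *v x = (L + E) *v (matrix_inv E *v y)"
    by (simp add: M_def y_def matrix_vector_mul_assoc[symmetric] del: transpose_matrix_vector)
  then have "x \<bullet> (M *v x) = y \<bullet> (matrix_inv E *v y)"
    by (simp add: y_def dot_lmul_matrix)
  also have "matrix_inv E *v y = (\<chi> i. y $ i / e i)"
    by (simp add: matrix_inv_E matrix_vector_mult_def if_distrib[of "\<lambda>y. y * _"] cong: if_cong)
  finally show ?thesis
    by (simp add: inner_vec_def y power2_eq_square)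
qed

text \<open>
  The transposed factor \<open>L + E\<close> is triangular with respect to the level: at a vertex of highest level
  among those with \<open>x $ i \<noteq> 0\<close> no successor contributes, so its summand is positive.
\<close>
lemma M_pos_def:
  assumes "x \<noteq> 0"
  shows "x \<bullet> (M *v x) > 0"
proof -
  obtain i0 where i0: "x $ i0 \<noteq> 0"
    using assms by (auto simp: vec_eq_iff)
  have "finite {i. x $ i \<noteq> 0}" "{i. x $ i \<noteq> 0} \<noteq> {}"
    using i0 by auto
  then have "Max (lev ` {i. x $ i \<noteq> 0}) \<in> lev ` {i. x $ i \<noteq> 0}"
    by (intro Max_in) auto
  then obtain i where i: "x $ i \<noteq> 0" "lev i = Max (lev ` {i. x $ i \<noteq> 0})"
    by auto
  have "lev j \<le> lev i" if "x $ j \<noteq> 0" for j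
    unfolding i(2) using that by (intro Max_ge) auto
  then have "x $ j = 0" if "j \<in> succ i" for j
    using lev_succ[OF that] by force
  then have "(e i * x $ i - q * (\<Sum>j\<in>succ i. x $ j))\<^sup>2 / e i > 0"
    using i(1) pivot_pos[of i] by simp
  then show ?thesis
    unfolding quadratic_form_M using pivot_pos
    by (intro sum_pos2[where i = i]) (auto simp: less_imp_le)
qed

text \<open>
  Completing the square in the form of \<open>M\<close> reproduces the mixed terms of \<open>A\<close>. What is left over at each
  vertex \<open>k\<close> is, by the pivot recursion, the dispersion of \<open>x\<close> over the successors of \<open>k\<close>: the fill-in
  between successors has been moved to the diagonal with the opposite sign.
\<close>
lemma form_A_minus_form_M:
  "x \<bullet> (A *v x) - x \<bullet> (M *v x)
    = (\<Sum>k\<in>UNIV. q\<^sup>2 / e k * (real (card (succ k)) * (\<Sum>j\<in>succ k. (x $ j)\<^sup>2) - (\<Sum>j\<in>succ k. x $ j)\<^sup>2))"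
proof -
  define S where "S k = (\<Sum>j\<in>succ k. x $ j)" for k
  have "(e i * x $ i - q * S i)\<^sup>2 / e i = e i * (x $ i)\<^sup>2 - 2 * q * (x $ i * S i) + q\<^sup>2 / e i * (S i)\<^sup>2" for i
    using pivot_pos[of i] by (simp add: field_simps power2_eq_square)
  then have "x \<bullet> (A *v x) - x \<bullet> (M *v x) = (\<Sum>i\<in>UNIV. (D i - e i) * (x $ i)\<^sup>2 - q\<^sup>2 / e i * (S i)\<^sup>2)"
    unfolding quadratic_form_A quadratic_form_M S_def[symmetric] sum_subtractf[symmetric]
    by (intro sum.cong) (auto simp: algebra_simps)
  also have "\<dots> = (\<Sum>i\<in>UNIV. (D i - e i) * (x $ i)\<^sup>2) - (\<Sum>i\<in>UNIV. q\<^sup>2 / e i * (S i)\<^sup>2)"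
    by (rule sum_subtractf)
  also have "(\<Sum>i\<in>UNIV. (D i - e i) * (x $ i)\<^sup>2)
      = (\<Sum>i\<in>UNIV. \<Sum>k | i \<in> succ k. q\<^sup>2 * real (card (succ k)) / e k * (x $ i)\<^sup>2)"
  proof (rule sum.cong)
    fix i
    have "D i - e i = (\<Sum>k | i \<in> succ k. q\<^sup>2 * real (card (succ k)) / e k)"
      using pivot[of i] by linarith
    then show "(D i - e i) * (x $ i)\<^sup>2
        = (\<Sum>k | i \<in> succ k. q\<^sup>2 * real (card (succ k)) / e k * (x $ i)\<^sup>2)"
      by (simp only: sum_distrib_right)
  qed simp
  also have "\<dots> = (\<Sum>k\<in>UNIV. \<Sum>i\<in>succ k. q\<^sup>2 * real (card (succ k)) / e k * (x $ i)\<^sup>2)"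
    by (rule sum_edges_swap)
  also have "\<dots> = (\<Sum>k\<in>UNIV. q\<^sup>2 / e k * (real (card (succ k)) * (\<Sum>j\<in>succ k. (x $ j)\<^sup>2)))"
    by (simp add: sum_distrib_left mult_ac)
  finally show ?thesis
    by (simp add: S_def sum_subtractf[symmetric] right_diff_distrib)
qed

lemma form_M_le_form_A: "x \<bullet> (M *v x) \<le> x \<bullet> (A *v x)"
proof -
  have "0 \<le> x \<bullet> (A *v x) - x \<bullet> (M *v x)"
    unfolding form_A_minus_form_M
  proof (intro sum_nonneg mult_nonneg_nonneg)
    fix k
    show "0 \<le> q\<^sup>2 / e k"
      using pivot_pos[of k] by simp
    show "0 \<le> real (card (succ k)) * (\<Sum>j\<in>succ k. (x $ j)\<^sup>2) - (\<Sum>j\<in>succ k. x $ j)\<^sup>2"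
      using sum_squared_le_sum_of_squares[of "\<lambda>j. x $ j" "succ k"] by (simp add: mult.commute)
  qed
  then show ?thesis by simp
qed

text \<open>
  The left-hand side is the form of the matrix with the off-diagonal entries of \<open>A\<close> and \<open>q\<close> times the
  number of incident edges on the diagonal. That number is at most \<open>2 d\<close>, so \<open>D\<close> dominates this diagonal.
\<close>
lemma edge_energy_le_form_A:
  "q * (\<Sum>k\<in>UNIV. \<Sum>j\<in>succ k. (x $ j - x $ k)\<^sup>2) \<le> x \<bullet> (A *v x)"
proof -
  have "(\<Sum>k\<in>UNIV. \<Sum>j\<in>succ k. (x $ j - x $ k)\<^sup>2)
      = (\<Sum>k\<in>UNIV. (\<Sum>j\<in>succ k. (x $ j)\<^sup>2) + real (card (succ k)) * (x $ k)\<^sup>2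
          - 2 * (x $ k * (\<Sum>j\<in>succ k. x $ j)))"
    by (simp add: power2_diff sum.distrib sum_subtractf sum_distrib_left mult_ac)
  also have "\<dots> = (\<Sum>k\<in>UNIV. \<Sum>j\<in>succ k. (x $ j)\<^sup>2)
      + (\<Sum>k\<in>UNIV. real (card (succ k)) * (x $ k)\<^sup>2 - 2 * (x $ k * (\<Sum>j\<in>succ k. x $ j)))"
    by (simp add: sum.distrib sum_subtractf)
  also have "(\<Sum>k\<in>UNIV. \<Sum>j\<in>succ k. (x $ j)\<^sup>2) = (\<Sum>i\<in>UNIV. real (card {k. i \<in> succ k}) * (x $ i)\<^sup>2)"
    using sum_edges_swap[of "\<lambda>k i. (x $ i)\<^sup>2"] by simp
  finally have "q * (\<Sum>k\<in>UNIV. \<Sum>j\<in>succ k. (x $ j - x $ k)\<^sup>2)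
      = (\<Sum>i\<in>UNIV. q * (real (card {k. i \<in> succ k}) + real (card (succ i))) * (x $ i)\<^sup>2
          - 2 * q * (x $ i * (\<Sum>j\<in>succ i. x $ j)))"
    by (simp add: sum.distrib[symmetric] sum_distrib_left algebra_simps)
  also have "\<dots> \<le> x \<bullet> (A *v x)"
    unfolding quadratic_form_A
  proof (intro sum_mono diff_right_mono mult_right_mono)
    fix i
    have "q * (real (card {k. i \<in> succ k}) + real (card (succ i))) \<le> q * (real d + real d)"
      using card_succ[of i] card_pred[of i] q_pos by (intro mult_left_mono) auto
    also have "\<dots> \<le> D i"
      using diag_ge[of i] by (simp add: algebra_simps)
    finally show "q * (real (card {k. i \<in> succ k}) + real (card (succ i))) \<le> D i" .
  qed simp
  finally show ?thesis .
qed

text \<open>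
  The dispersion at \<open>k\<close> is at most the degree times the energy of the edges leaving \<open>k\<close>, and the lower
  bound on the pivots turns its coefficient into at most \<open>q r\<close> with \<open>r = (m + 1) / (m + 2) < 1\<close>. Hence
  the form of \<open>A - M\<close> is at most \<open>r\<close> times that of \<open>A\<close>, which leaves at least the fraction
  \<open>1 - r = 1 / (m + 2)\<close> of it for \<open>M\<close>.
\<close>
lemma form_A_le_form_M:
  assumes m: "\<And>i. lev i \<le> m"
  shows "x \<bullet> (A *v x) \<le> (real m + 2) * (x \<bullet> (M *v x))"
proof -
  define r where "r = (real m + 1) / (real m + 2)"
  let ?en = "\<lambda>k. \<Sum>j\<in>succ k. (x $ j - x $ k)\<^sup>2"
  have coeff: "q\<^sup>2 / e k * real (card (succ k)) \<le> q * r" for k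
  proof -
    have "1 / (real m + 1) \<le> 1 / (real (lev k) + 1)"
      using m[of k] by (intro divide_left_mono) auto
    then have "real d * q * (1 + 1 / (real m + 1)) \<le> real d * q * (1 + 1 / (real (lev k) + 1))"
      using q_pos by (intro mult_left_mono) auto
    then have ek: "real d * q * (1 + 1 / (real m + 1)) \<le> e k"
      using pivot_ge[of k] by linarith
    have pos: "real d * q * (1 + 1 / (real m + 1)) > 0"
      using d_pos q_pos by (intro mult_pos_pos) (auto intro: add_pos_nonneg)
    have "q\<^sup>2 * real (card (succ k)) / e k \<le> q\<^sup>2 * real d / (real d * q * (1 + 1 / (real m + 1)))"
      using ek pos card_succ[of k] by (intro frac_le) (auto intro: mult_left_mono)
    also have "\<dots> = q * r"
    proof -
      have "1 + 1 / (real m + 1) = (real m + 2) / (real m + 1)"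
        by (simp add: field_simps)
      then show ?thesis
        using d_pos q_pos by (simp add: r_def power2_eq_square)
    qed
    finally show ?thesis by simp
  qed
  have "x \<bullet> (A *v x) - x \<bullet> (M *v x) \<le> (\<Sum>k\<in>UNIV. q * r * ?en k)"
    unfolding form_A_minus_form_M
  proof (rule sum_mono)
    fix k
    have "q\<^sup>2 / e k * (real (card (succ k)) * (\<Sum>j\<in>succ k. (x $ j)\<^sup>2) - (\<Sum>j\<in>succ k. x $ j)\<^sup>2)
        \<le> q\<^sup>2 / e k * (real (card (succ k)) * ?en k)"
      using pivot_pos[of k] by (intro mult_left_mono sum_dispersion_le) simp
    also have "\<dots> = q\<^sup>2 / e k * real (card (succ k)) * ?en k"
      by simp
    also have "\<dots> \<le> q * r * ?en k"
      by (intro mult_right_mono coeff sum_nonneg) simp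
    finally show "q\<^sup>2 / e k * (real (card (succ k)) * (\<Sum>j\<in>succ k. (x $ j)\<^sup>2) - (\<Sum>j\<in>succ k. x $ j)\<^sup>2)
        \<le> q * r * ?en k" .
  qed
  also have "\<dots> = r * (q * (\<Sum>k\<in>UNIV. ?en k))"
    by (simp add: sum_distrib_left mult_ac)
  also have "\<dots> \<le> r * (x \<bullet> (A *v x))"
    by (intro mult_left_mono edge_energy_le_form_A) (simp add: r_def)
  finally have "(1 - r) * (x \<bullet> (A *v x)) \<le> x \<bullet> (M *v x)"
    by (simp add: algebra_simps)
  moreover have "1 - r = 1 / (real m + 2)"
    by (simp add: r_def field_simps)
  ultimately show ?thesis
    by (simp add: field_simps)
qed

theorem cond_number_le:
  assumes "\<And>i. lev i \<le> m"
  shows "cond_number (matrix_inv M ** A) \<le> real m + 2"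
  using cond_number_le_if_form_bounds[OF transpose_A transpose_M M_pos_def form_M_le_form_A
      form_A_le_form_M[OF assms]] .

end

section \<open>The finite difference grid\<close>

lemma lex_less_add_axis:
  fixes K :: "real^'d::{finite,linorder}"
  assumes "h > 0"
  shows "lex_less K (K + h *\<^sub>R axis i 1)"
  unfolding lex_less_def less_fun_def
  using assms by (intro exI[of _ i]) (auto simp: axis_def)

lemma not_lex_less_diff_axis:
  fixes K :: "real^'d::{finite,linorder}"
  assumes "h > 0"
  shows "\<not> lex_less K (K - h *\<^sub>R axis i 1)"
proof -
  have "lex_less (K - h *\<^sub>R axis i 1) K"
    using lex_less_add_axis[OF assms, of "K - h *\<^sub>R axis i 1" i] by simp
  then show ?thesis
    using lex_less_trans not_lex_less_self by blast
qed

lemma adjacent_sym: "adjacent h K K' \<longleftrightarrow> adjacent h K' K"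
proof -
  have "K' = K + h *\<^sub>R axis i 1 \<longleftrightarrow> K = K' - h *\<^sub>R axis i 1"
    "K' = K - h *\<^sub>R axis i 1 \<longleftrightarrow> K = K' + h *\<^sub>R axis i 1" for i
    by (auto simp: algebra_simps)
  then show ?thesis
    unfolding adjacent_def by auto
qed

lemma adjacent_irrefl:
  assumes "h > 0"
  shows "\<not> adjacent h K K"
  using assms by (auto simp: adjacent_def)

lemma mem_successors_iff:
  fixes K K' :: "real^'d::{finite,linorder}"
  assumes "h > 0"
  shows "K' \<in> successors \<Omega> a h N K \<longleftrightarrow> K' \<in> vertices \<Omega> a h N \<and> (\<exists>i. K' = K + h *\<^sub>R axis i 1)"
  using lex_less_add_axis[OF assms, of K] not_lex_less_diff_axis[OF assms, of K]
  by (auto simp: successors_def inner_nbrs_def adjacent_def)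

lemma mem_precursors_iff:
  fixes K K' :: "real^'d::{finite,linorder}"
  assumes "h > 0" and "K \<in> vertices \<Omega> a h N"
  shows "K' \<in> precursors \<Omega> a h N K \<longleftrightarrow> K' \<in> vertices \<Omega> a h N \<and> K \<in> successors \<Omega> a h N K'"
  using assms(2) adjacent_sym[of h K K'] by (auto simp: precursors_def successors_def inner_nbrs_def)

lemma mem_inner_nbrs_iff:
  fixes K K' :: "real^'d::{finite,linorder}"
  assumes "h > 0" and "K \<in> vertices \<Omega> a h N" and "K' \<in> vertices \<Omega> a h N"
  shows "K' \<in> inner_nbrs \<Omega> a h N K \<longleftrightarrow> K' \<in> successors \<Omega> a h N K \<or> K \<in> successors \<Omega> a h N K'"
proof -
  have "K' = K - h *\<^sub>R axis i 1 \<longleftrightarrow> K = K' + h *\<^sub>R axis i 1" for i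
    by (auto simp: algebra_simps)
  then show ?thesis
    using assms by (auto simp: mem_successors_iff inner_nbrs_def adjacent_def)
qed

lemma card_successors_le:
  fixes K :: "real^'d::{finite,linorder}"
  assumes "h > 0"
  shows "card (successors \<Omega> a h N K) \<le> CARD('d)"
proof -
  have "successors \<Omega> a h N K \<subseteq> range (\<lambda>i. K + h *\<^sub>R axis i 1)"
    using mem_successors_iff[OF assms] by blast
  then show ?thesis
    by (meson card_image_le card_mono finite finite_imageI order_trans)
qed

lemma card_precursors_le:
  fixes K :: "real^'d::{finite,linorder}"
  assumes "h > 0" and "K \<in> vertices \<Omega> a h N"
  shows "card (precursors \<Omega> a h N K) \<le> CARD('d)"
proof -
  have "K' \<in> range (\<lambda>i. K - h *\<^sub>R axis i 1)" if K': "K' \<in> precursors \<Omega> a h N K" for K'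
  proof -
    obtain i where "K = K' + h *\<^sub>R axis i 1"
      using K' by (auto simp: mem_precursors_iff[OF assms] mem_successors_iff[OF assms(1)])
    then show ?thesis
      by (intro range_eqI[of _ _ i]) simp
  qed
  then have "precursors \<Omega> a h N K \<subseteq> range (\<lambda>i. K - h *\<^sub>R axis i 1)"
    by blast
  then show ?thesis
    by (meson card_image_le card_mono finite finite_imageI order_trans)
qed

lemma card_adjacent:
  fixes K :: "real^'d"
  assumes "h > 0"
  shows "card {K'. adjacent h K K'} = 2 * CARD('d)"
proof -
  let ?U = "range (\<lambda>i. K + h *\<^sub>R axis i 1)" and ?V = "range (\<lambda>i. K - h *\<^sub>R axis i 1)"
  have "{K'. adjacent h K K'} = ?U \<union> ?V"
    by (auto simp: adjacent_def)
  moreover have "?U \<inter> ?V = {}"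
  proof -
    have "(K + h *\<^sub>R axis i 1) $ i \<noteq> (K - h *\<^sub>R axis j 1) $ i" for i j
      using assms by (auto simp: axis_def)
    then show ?thesis
      by (metis (no_types, lifting) disjoint_iff imageE)
  qed
  moreover have "inj (\<lambda>i. K + h *\<^sub>R axis i 1)" "inj (\<lambda>i. K - h *\<^sub>R axis i 1)"
    using assms by (auto simp: inj_def axis_eq_axis)
  ultimately show ?thesis
    by (simp add: card_Un_disjoint card_image)
qed

text \<open>
  A grid point in the open box has no extreme index in any direction, so a step by one index does not
  leave the grid.
\<close>
lemma adjacent_in_grid:
  fixes K :: "real^'d"
  assumes h: "h > 0" and side: "\<forall>i. b $ i - a $ i = h * real (N $ i)"
    and K: "K \<in> grid a h N" "K \<in> box a b" and adj: "adjacent h K K'"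
  shows "K' \<in> grid a h N"
proof -
  obtain k where k: "K = (\<chi> i. a $ i + h * real (k $ i))" "\<forall>i. k $ i \<le> N $ i"
    using K(1) unfolding grid_def by blast
  have inside: "0 < k $ i \<and> k $ i < N $ i" for i
  proof -
    have "a $ i < K $ i" "K $ i < b $ i"
      using K(2) by (auto simp: mem_box_cart)
    then have "0 < h * real (k $ i)" "h * real (k $ i) < h * real (N $ i)"
      using side[rule_format, of i] by (simp_all add: k(1))
    then show ?thesis
      using h by (simp add: zero_less_mult_iff)
  qed
  obtain i where "K' = K + h *\<^sub>R axis i 1 \<or> K' = K - h *\<^sub>R axis i 1"
    using adj by (auto simp: adjacent_def)
  then show ?thesis
  proof
    assume "K' = K + h *\<^sub>R axis i 1"
    then have "K' = (\<chi> j. a $ j + h * real ((\<chi> j. if j = i then k $ j + 1 else k $ j) $ j))"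
      by (simp add: k(1) vec_eq_iff axis_def algebra_simps)
    moreover have "\<forall>j. (\<chi> j. if j = i then k $ j + 1 else k $ j) $ j \<le> N $ j"
      using inside by (simp add: Suc_leI less_imp_le)
    ultimately show ?thesis
      unfolding grid_def by blast
  next
    assume "K' = K - h *\<^sub>R axis i 1"
    then have "K' = (\<chi> j. a $ j + h * real ((\<chi> j. if j = i then k $ j - 1 else k $ j) $ j))"
      using inside[of i] by (auto simp: k(1) vec_eq_iff axis_def right_diff_distrib of_nat_diff)
    moreover have "\<forall>j. (\<chi> j. if j = i then k $ j - 1 else k $ j) $ j \<le> N $ j"
      using k(2) by (auto intro: le_trans[OF diff_le_self])
    ultimately show ?thesis
      unfolding grid_def by blast
  qed
qed

text \<open>
  The segment is connected and leaves \<open>\<Omega>\<close>, so it meets the frontier; \<open>K\<close> itself, lying in an open set, is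
  not on the frontier.
\<close>
lemma bdist_bounds:
  fixes K K' :: "real^'d"
  assumes "open \<Omega>" "K \<in> \<Omega>" "K' \<notin> \<Omega>"
  shows "0 < bdist \<Omega> K K'" and "bdist \<Omega> K K' \<le> dist K K'"
proof -
  let ?F = "frontier \<Omega> \<inter> closed_segment K K'"
  have ne: "?F \<noteq> {}"
    using connected_Int_frontier[OF connected_segment(1)[of K K'], of \<Omega>] assms(2,3)
    by (auto simp: Int_commute)
  have "K \<notin> frontier \<Omega>"
    using assms(1,2) by (simp add: frontier_def interior_open)
  moreover have "closed ?F"
    by (intro closed_Int frontier_closed closed_segment)
  ultimately show "0 < bdist \<Omega> K K'"
    unfolding bdist_def using infdist_pos_not_in_closed[OF _ ne] by simp
  obtain z where z: "z \<in> ?F"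
    using ne by blast
  then have "infdist K ?F \<le> dist K z"
    by (rule infdist_le)
  also have "\<dots> \<le> dist K K'"
    using z dist_in_closed_segment by (metis IntD2 dist_commute)
  finally show "bdist \<Omega> K K' \<le> dist K K'"
    unfolding bdist_def .
qed

text \<open>
  An open domain contained in the closed box misses its faces, so all \<open>2 d\<close> neighbours of a vertex belong
  to the grid. Each inner one contributes \<open>1 / h\<^sup>2\<close>, and each outer one at least as much, since the boundary is at
  distance at most \<open>h\<close>. Positivity of the distance matters here: division by \<open>0\<close> would give \<open>0\<close>.
\<close>
lemma poisson_diagonal_ge:
  fixes K :: "real^'d"
  assumes "open \<Omega>" and h: "h > 0" and side: "\<forall>i. b $ i - a $ i = h * real (N $ i)"
    and sub: "\<Omega> \<subseteq> cbox a b" and K: "K \<in> vertices \<Omega> a h N"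
  shows "2 * real CARD('d) * (1 / h\<^sup>2) \<le> poisson \<Omega> a h N K K"
proof -
  let ?I = "inner_nbrs \<Omega> a h N K" and ?O = "outer_nbrs \<Omega> a h N K"
  have KO: "K \<in> \<Omega>" and Kg: "K \<in> grid a h N"
    using K by (auto simp: vertices_def)
  have "\<Omega> \<subseteq> box a b"
    using interior_maximal[OF sub \<open>open \<Omega>\<close>] by simp
  then have "{K'. adjacent h K K'} = ?I \<union> ?O"
    using adjacent_in_grid[OF h side Kg] KO
    by (auto simp: inner_nbrs_def outer_nbrs_def vertices_def)
  moreover have "finite ?I" "finite ?O" "?I \<inter> ?O = {}"
    by (auto simp: inner_nbrs_def outer_nbrs_def vertices_def finite_grid)
  ultimately have "card ?I + card ?O = 2 * CARD('d)"
    using card_adjacent[OF h, of K] by (simp add: card_Un_disjoint)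
  then have count: "real (card ?I) + real (card ?O) = 2 * real CARD('d)"
    by linarith
  have "1 / h\<^sup>2 \<le> 1 / (bdist \<Omega> K K' * h)" if "K' \<in> ?O" for K'
  proof -
    have K': "K' \<notin> \<Omega>" "adjacent h K K'"
      using that by (auto simp: outer_nbrs_def)
    have "dist K K' = h"
      using K'(2) h by (auto simp: adjacent_def dist_norm norm_axis_1)
    then show ?thesis
      using bdist_bounds[OF \<open>open \<Omega>\<close> KO K'(1)] h
      by (intro divide_left_mono) (auto simp: power2_eq_square)
  qed
  then have "(\<Sum>K'\<in>?O. 1 / h\<^sup>2) \<le> (\<Sum>K'\<in>?O. 1 / (bdist \<Omega> K K' * h))"
    by (rule sum_mono)
  moreover have "K \<notin> ?I"
    using adjacent_irrefl[OF h] by (auto simp: inner_nbrs_def)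
  ultimately have "(real (card ?I) + real (card ?O)) * (1 / h\<^sup>2) \<le> poisson \<Omega> a h N K K"
    by (simp add: poisson_def distrib_right add_divide_distrib)
  then show ?thesis
    by (simp only: count)
qed

text \<open>
  All entries in the recursion are off-diagonal entries between neighbours, so the inner sum only counts
  the successors.
\<close>
lemma milu_pivot_uniform:
  fixes K :: "real^'d::{finite,linorder}"
  assumes h: "h > 0" and K: "K \<in> vertices \<Omega> a h N"
  shows "milu_pivot \<Omega> a h N K = poisson \<Omega> a h N K K
    - (\<Sum>K1\<in>precursors \<Omega> a h N K. (1 / h\<^sup>2)\<^sup>2 * real (card (successors \<Omega> a h N K1)) / milu_pivot \<Omega> a h N K1)"
proof -
  have "(\<Sum>K2\<in>successors \<Omega> a h N K1.
            poisson \<Omega> a h N K K1 * poisson \<Omega> a h N K1 K2 / milu_pivot \<Omega> a h N K1)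
      = (1 / h\<^sup>2)\<^sup>2 * real (card (successors \<Omega> a h N K1)) / milu_pivot \<Omega> a h N K1"
    if K1: "K1 \<in> precursors \<Omega> a h N K" for K1
  proof -
    have K1v: "K1 \<in> vertices \<Omega> a h N" and s: "K \<in> successors \<Omega> a h N K1"
      using K1 mem_precursors_iff[OF h K] by auto
    have entry: "poisson \<Omega> a h N K K1 = - (1 / h\<^sup>2)"
      using s by (simp add: poisson_def successors_def)
    have "poisson \<Omega> a h N K1 K2 = - (1 / h\<^sup>2)" if "K2 \<in> successors \<Omega> a h N K1" for K2
      using that K1v adjacent_sym[of h K1 K2] by (simp add: poisson_def successors_def inner_nbrs_def)
    then show ?thesis
      by (simp add: entry power2_eq_square)
  qed
  then show ?thesis
    by (subst milu_pivot.simps) simp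
qed

section \<open>The condition number for the Poisson matrix\<close>

text \<open>
  The level of a vertex is the sum of its index coordinates. Expressing it through the real coordinates
  avoids choosing indices: a step to a successor adds \<open>1\<close> to the sum of \<open>(K $ k - a $ k) / h\<close>, which is
  nonnegative because vertices lie in the box, and this is enough for the floor to rise by exactly one.
\<close>
lemma milu_digraph_of_grid:
  fixes \<Omega> :: "(real^'d::{finite,linorder}) set" and v :: "'v::finite \<Rightarrow> real^'d::{finite,linorder}"
  assumes "open \<Omega>" and h: "h > 0" and side: "\<forall>i. b $ i - a $ i = h * real (N $ i)"
    and sub: "\<Omega> \<subseteq> cbox a b" and v: "bij_betw v UNIV (vertices \<Omega> a h N)"
  shows "milu_digraph (\<lambda>i. {j. v j \<in> successors \<Omega> a h N (v i)})
    (\<lambda>i. nat \<lfloor>\<Sum>k\<in>UNIV. (v i $ k - a $ k) / h\<rfloor>) CARD('d) (1 / h\<^sup>2)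
    (\<lambda>i. poisson \<Omega> a h N (v i) (v i)) (\<lambda>i. milu_pivot \<Omega> a h N (v i))"
proof -
  have inj: "inj v" and ran: "range v = vertices \<Omega> a h N"
    using v by (auto simp: bij_betw_def)
  have vert: "v i \<in> vertices \<Omega> a h N" for i
    using ran by blast
  have nonneg: "0 \<le> (\<Sum>k\<in>UNIV. (v i $ k - a $ k) / h)" for i
  proof -
    have "v i \<in> cbox a b"
      using vert[of i] sub by (auto simp: vertices_def)
    then show ?thesis
      using h by (intro sum_nonneg) (auto simp: mem_box_cart)
  qed
  have preds: "{k. v i \<in> successors \<Omega> a h N (v k)} = v -` precursors \<Omega> a h N (v i)" for i
    using mem_precursors_iff[OF h vert] vert by auto
  have reindex: "bij_betw v (v -` S) S" if "S \<subseteq> vertices \<Omega> a h N" for S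
    using that inj ran by (auto simp: bij_betw_def inj_on_def)
  have succ_bij: "bij_betw v {j. v j \<in> successors \<Omega> a h N K} (successors \<Omega> a h N K)" for K
    using reindex[of "successors \<Omega> a h N K"] by (auto simp: vimage_def successors_def inner_nbrs_def)
  have prec_bij: "bij_betw v {k. v i \<in> successors \<Omega> a h N (v k)} (precursors \<Omega> a h N (v i))" for i
    unfolding preds by (rule reindex) (auto simp: precursors_def inner_nbrs_def)
  show ?thesis
  proof
    fix i j
    assume "j \<in> {j. v j \<in> successors \<Omega> a h N (v i)}"
    then obtain k0 where k0: "v j = v i + h *\<^sub>R axis k0 1"
      by (auto simp: mem_successors_iff[OF h])
    have "(v j $ k - a $ k) / h = (v i $ k - a $ k) / h + (if k = k0 then 1 else 0)" for k
      using h by (simp add: k0 axis_def field_simps)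
    then have "(\<Sum>k\<in>UNIV. (v j $ k - a $ k) / h) = (\<Sum>k\<in>UNIV. (v i $ k - a $ k) / h) + 1"
      by (simp add: sum.distrib)
    then show "nat \<lfloor>\<Sum>k\<in>UNIV. (v j $ k - a $ k) / h\<rfloor> = Suc (nat \<lfloor>\<Sum>k\<in>UNIV. (v i $ k - a $ k) / h\<rfloor>)"
      using nonneg[of i] by (simp add: Suc_nat_eq_nat_zadd1 add.commute)
  next
    show "0 < CARD('d)" "0 < 1 / h\<^sup>2"
      using h by simp_all
  next
    fix i
    show "card {j. v j \<in> successors \<Omega> a h N (v i)} \<le> CARD('d)"
      using card_successors_le[OF h] bij_betw_same_card[OF succ_bij] by metis
    show "card {k. i \<in> {j. v j \<in> successors \<Omega> a h N (v k)}} \<le> CARD('d)"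
      using card_precursors_le[OF h vert[of i]] bij_betw_same_card[OF prec_bij[of i]] by simp
    show "2 * real CARD('d) * (1 / h\<^sup>2) \<le> poisson \<Omega> a h N (v i) (v i)"
      by (rule poisson_diagonal_ge[OF assms(1) h side sub vert])
    show "milu_pivot \<Omega> a h N (v i) = poisson \<Omega> a h N (v i) (v i)
      - (\<Sum>k | i \<in> {j. v j \<in> successors \<Omega> a h N (v k)}. (1 / h\<^sup>2)\<^sup>2
          * real (card {j. v j \<in> successors \<Omega> a h N (v k)}) / milu_pivot \<Omega> a h N (v k))"
      unfolding milu_pivot_uniform[OF h vert[of i]]
      using sum.reindex_bij_betw[OF prec_bij[of i],
          of "\<lambda>K. (1 / h\<^sup>2)\<^sup>2 * real (card (successors \<Omega> a h N K)) / milu_pivot \<Omega> a h N K"]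
      by (simp add: bij_betw_same_card[OF succ_bij])
  qed
qed

theorem corollary3p1:
  fixes \<Omega> :: "(real ^ 'd::{finite,linorder}) set"
    and a b :: "real ^ 'd::{finite,linorder}" and N :: "nat ^ 'd::{finite,linorder}" and h :: real
    and v :: "'v::finite \<Rightarrow> real ^ 'd::{finite,linorder}"
  assumes "CARD('d) = 2 \<or> CARD('d) = 3"
    and "open \<Omega>" and "connected \<Omega>" and "bounded \<Omega>"
    and "h > 0"
    and "\<forall>i. b $ i - a $ i = h * real (N $ i)"
    and "\<Omega> \<subseteq> cbox a b"
    and "bij_betw v UNIV (vertices \<Omega> a h N)"
  shows "cond_number (matrix_inv (milu \<Omega> a h N v) ** poisson_matrix \<Omega> a h N v)
           \<le> 1 + real CARD('d) + real CARD('d) * (MAX i. b $ i - a $ i) / h"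
proof -
  note h = \<open>h > 0\<close>
  interpret G: milu_digraph "\<lambda>i. {j. v j \<in> successors \<Omega> a h N (v i)}"
    "\<lambda>i. nat \<lfloor>\<Sum>k\<in>UNIV. (v i $ k - a $ k) / h\<rfloor>" "CARD('d)" "1 / h\<^sup>2"
    "\<lambda>i. poisson \<Omega> a h N (v i) (v i)" "\<lambda>i. milu_pivot \<Omega> a h N (v i)"
    by (rule milu_digraph_of_grid[OF assms(2,5,6,7,8)])
  have vert: "v i \<in> vertices \<Omega> a h N" for i
    using assms(8) by (auto simp: bij_betw_def)
  have inj: "v i = v j \<longleftrightarrow> i = j" for i j
    using assms(8) by (auto simp: bij_betw_def inj_eq)
  have entry: "poisson \<Omega> a h N (v i) (v j)
      = (if v j \<in> successors \<Omega> a h N (v i) \<or> v i \<in> successors \<Omega> a h N (v j) then - (1 / h\<^sup>2)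
         else if i = j then poisson \<Omega> a h N (v i) (v i) else 0)" for i j
    using mem_inner_nbrs_iff[OF h vert[of j] vert[of i]] inj[of i j] by (auto simp: poisson_def)
  have "poisson_matrix \<Omega> a h N v $ i $ j = G.A $ i $ j" for i j
    using entry[of i j] by (simp add: poisson_matrix_def G.A_def)
  then have A: "poisson_matrix \<Omega> a h N v = G.A"
    by (simp add: vec_eq_iff)
  have "lower_part \<Omega> a h N v $ i $ j = G.L $ i $ j" for i j
    using entry[of i j] mem_precursors_iff[OF h vert[of i], of "v j"] vert[of j]
    by (simp add: lower_part_def poisson_matrix_def G.L_def)
  then have L: "lower_part \<Omega> a h N v = G.L"
    by (simp add: vec_eq_iff)
  have E: "pivot_matrix \<Omega> a h N v = G.E"
    by (simp add: pivot_matrix_def G.E_def)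
  have M: "milu \<Omega> a h N v = G.M"
    by (simp add: milu_def G.M_def L E Let_def)
  let ?l = "MAX i. b $ i - a $ i" and ?s = "\<Sum>k\<in>UNIV. (b $ k - a $ k) / h"
  have lev: "nat \<lfloor>\<Sum>k\<in>UNIV. (v i $ k - a $ k) / h\<rfloor> \<le> nat \<lfloor>?s\<rfloor>" for i
  proof -
    have "v i \<in> cbox a b"
      using vert[of i] assms(7) by (auto simp: vertices_def)
    then show ?thesis
      using h by (intro nat_mono floor_mono sum_mono divide_right_mono) (auto simp: mem_box_cart)
  qed
  have "0 \<le> ?s"
    using h assms(6) by (intro sum_nonneg) simp
  then have "real (nat \<lfloor>?s\<rfloor>) \<le> ?s"
    by simp
  also have "\<dots> \<le> (\<Sum>k\<in>(UNIV :: 'd set). ?l / h)"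
    using h by (intro sum_mono divide_right_mono Max_ge) auto
  also have "\<dots> = real CARD('d) * ?l / h"
    by simp
  \<comment> \<open>This absorbs the offset \<open>2\<close>, since \<open>2 \<le> 1 + d\<close>.\<close>
  finally have "real (nat \<lfloor>?s\<rfloor>) + 2 \<le> 1 + real CARD('d) + real CARD('d) * ?l / h"
    using assms(1) by auto
  then show ?thesis
    unfolding A M using G.cond_number_le[OF lev] by linarith
qed

end
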